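(* Let $k\ge1$ and $l\ge1$ be integers, let $G$ be a graph of order $n$ with minimum degree $\delta$, and put $\widehat\delta=\delta-\max\{k,l\}+1$, $b_t=\binom{\delta}{t}$ for integers $t\ge0$, and $b_{-1}=0$. If $\widehat\delta>0$, then $$\gamma_{k,l}(G)\le\left(1-\frac{\widehat\delta}{(1+\widehat\delta)^{1+1/\widehat\delta}\;(b_{k-1}+b_{l-2})^{1/\widehat\delta}}\right)n .$$ Also, if $\delta\ge\max\{k,l-1\}$, then $$\gamma_{k,l}(G)\le\frac{\ln(\widehat\delta+1)+\ln(b_{k-1}+b_{l-2})+1}{\widehat\delta+1}\,n .$$
   Context: All graphs are finite, undirected, without loops and multiple edges (and nonempty). $N[v]$ denotes the closed neighbourhood of $v$ (the neighbours of $v$ together with $v$). For integers $k\ge1$ and $l\ge1$, a set $D\subseteq V(G)$ is a $(k,l)$-dominating set of $G$ if $|N[v]\cap D|\ge k$ for every vertex $v\notin D$ and $|N[v]\cap D|\ge l$ for every vertex $v\in D$. The parametric domination number $\gamma_{k,l}(G)$ is the minimum cardinality of a $(k,l)$-dominating set of $G$; it is considered for graphs with minimum degree at least $\max\{k,l-1\}$. *)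

theory Defs
  imports Complex_Main "Graph_Theory.Pair_Digraph"
begin

text \<open>
  A finite simple undirected graph is a \<open>pair_graph\<close>: an edge \<open>{u, v}\<close> is represented by the
  two arcs \<open>(u, v)\<close> and \<open>(v, u)\<close>. The degree of a vertex is therefore its out-degree.
\<close>

definition min_degree :: "'a pair_pre_digraph \<Rightarrow> nat" where
  "min_degree G = Min (out_degree (with_proj G) ` pverts G)"

definition closed_nbhd :: "'a pair_pre_digraph \<Rightarrow> 'a \<Rightarrow> 'a set" where
  "closed_nbhd G v = insert v {u. (v, u) \<in> parcs G}"

definition kl_dominating_set :: "nat \<Rightarrow> nat \<Rightarrow> 'a pair_pre_digraph \<Rightarrow> 'a set \<Rightarrow> bool" where
  "kl_dominating_set k l G D \<longleftrightarrow>
     D \<subseteq> pverts G \<and>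
     (\<forall>v \<in> pverts G - D. k \<le> card (closed_nbhd G v \<inter> D)) \<and>
     (\<forall>v \<in> D. l \<le> card (closed_nbhd G v \<inter> D))"

text \<open>
  The minimum below is over a nonempty set as soon as the minimum degree of \<open>G\<close> is at least
  \<open>l - 1\<close>, since then \<open>pverts G\<close> itself is dominating; otherwise the value may be meaningless.
\<close>

definition parametric_domination_number :: "nat \<Rightarrow> nat \<Rightarrow> 'a pair_pre_digraph \<Rightarrow> nat" where
  "parametric_domination_number k l G = Min (card ` {D. kl_dominating_set k l G D})"

end

theory Submission
  imports Defs
begin

text \<open>
  The proof is by alteration of a random set. For each vertex \<open>v\<close> fix a set \<open>N v\<close> of exactly
  \<open>\<delta>\<close> neighbours, and let \<open>A\<close> contain each vertex independently with probability \<open>1 - q\<close>.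
  A vertex \<open>v\<close> with fewer than \<open>t\<close> members of \<open>A\<close> in \<open>N v\<close>, where \<open>t\<close> is the target of \<open>v\<close>,
  contributes the missing number of vertices from \<open>N v - A\<close>; the union \<open>D\<close> of \<open>A\<close> and
  all contributions has expected size at most \<open>(1 - q) n\<close> plus the sum of the expected deficits.

  A vertex outside \<open>A\<close> may be contributed by another vertex and then lies in \<open>D\<close>, where it needs
  \<open>l - 1\<close> neighbours in \<open>D\<close> rather than \<open>k\<close>. The target \<open>max k (l - 1)\<close> outside \<open>A\<close>, and
  \<open>l - 1\<close> inside \<open>A\<close>, therefore makes \<open>D\<close> dominating after a single round of contributions.

  Two observations make the expected deficit small. First, a vertex with \<open>X < t\<close>
  chosen neighbours has deficit \<open>t - X\<close> at most the number of \<open>(t - 1)\<close>-subsets \<open>S\<close> of \<open>N v\<close>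
  containing the chosen ones (\<open>deficit_le_card_supersets\<close>). Each such event says that
  \<open>A\<close> avoids the \<open>\<delta> - t + 1\<close> vertices of \<open>N v - S\<close>, so
  the expected deficit is at most \<open>(\<delta> choose (t - 1)) q ^ (\<delta> - t + 1)\<close>, with one more factor
  \<open>q\<close> if \<open>v \<notin> A\<close> is required as well (\<open>expected_deficit_le\<close>). Second, if \<open>l > k\<close> both targets
  equal \<open>l - 1\<close>, and one term suffices; if \<open>l \<le> k\<close> the targets are \<open>k\<close> and \<open>l - 1\<close>, and
  the factor \<open>q\<close> of the first one brings its exponent to \<open>\<delta> - k + 2\<close>, at most that of the second.
  In both cases, writing \<open>c\<close> for the sum of the two binomial coefficients, the domination number is at most
  \<open>(1 - q + c q ^ (\<delta> - max k l + 2)) n\<close> (\<open>parametric_domination_number_le_poly\<close>).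

  The first inequality is this bound at its minimum over \<open>q\<close>. The second uses
  \<open>q = 1 - p \<le> exp (- p)\<close> and the \<open>p\<close> that minimises the resulting function.
\<close>

section \<open>Random vertex subsets\<close>

text \<open>
  The probability that a random subset of \<open>V\<close>, which omits each element independently with
  probability \<open>q\<close>, equals \<open>A\<close>. Expectations are written as weighted sums over \<open>Pow V\<close>.
\<close>
definition subset_weight :: "'a set \<Rightarrow> real \<Rightarrow> 'a set \<Rightarrow> real" where
  "subset_weight V q A = (1 - q) ^ card A * q ^ card (V - A)"

lemma subset_weight_nonneg: "0 \<le> q \<Longrightarrow> q \<le> 1 \<Longrightarrow> 0 \<le> subset_weight V q A"
  by (simp add: subset_weight_def)

lemma sum_subset_weight:
  assumes "finite V"
  shows "(\<Sum>A\<in>Pow V. subset_weight V q A) = 1"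
  using prod_add[OF assms, of "\<lambda>_. 1 - q" "\<lambda>_. q"] by (simp add: subset_weight_def)

text \<open>
  Independence enters through this lemma only: all events used below say that
  the random set misses a given set.
\<close>
lemma sum_subset_weight_avoid:
  assumes "finite V" "T \<subseteq> V"
  shows "(\<Sum>A\<in>Pow V. subset_weight V q A * of_bool (A \<inter> T = {})) = q ^ card T"
proof -
  have split: "subset_weight V q A = subset_weight (V - T) q A * q ^ card T"
    if "A \<in> Pow (V - T)" for A
  proof -
    have "V - A = (V - T - A) \<union> T" "(V - T - A) \<inter> T = {}" using that assms by auto
    moreover have "finite T" "finite (V - T - A)" using assms finite_subset by auto
    ultimately have "card (V - A) = card (V - T - A) + card T"
      by (metis card_Un_disjoint)
    then show ?thesis by (simp add: subset_weight_def power_add)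
  qed
  have "(\<Sum>A\<in>Pow V. subset_weight V q A * of_bool (A \<inter> T = {}))
      = (\<Sum>A\<in>Pow (V - T). subset_weight V q A)"
    by (rule sum.mono_neutral_cong_right) (use assms in auto)
  also have "\<dots> = (\<Sum>A\<in>Pow (V - T). subset_weight (V - T) q A) * q ^ card T"
    by (simp add: split sum_distrib_right)
  also have "\<dots> = q ^ card T"
    using assms by (simp add: sum_subset_weight)
  finally show ?thesis .
qed

lemma sum_subset_weight_card:
  assumes "finite V"
  shows "(\<Sum>A\<in>Pow V. subset_weight V q A * real (card A)) = real (card V) * (1 - q)"
proof -
  (* By linearity of expectation; membership is expressed as the complement of avoiding {v}. *)
  have card_eq: "real (card A) = (\<Sum>v\<in>V. 1 - of_bool (A \<inter> {v} = {}))" if "A \<in> Pow V" for A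
  proof -
    have "(\<Sum>v\<in>V. 1 - of_bool (A \<inter> {v} = {}) :: real) = (\<Sum>v\<in>V. of_bool (v \<in> A))"
      by (rule sum.cong) auto
    also have "\<dots> = real (card (V \<inter> A))"
      using assms by (simp add: Int_def)
    also have "V \<inter> A = A" using that by auto
    finally show ?thesis by simp
  qed
  have "(\<Sum>A\<in>Pow V. subset_weight V q A * real (card A))
      = (\<Sum>A\<in>Pow V. \<Sum>v\<in>V. subset_weight V q A
            - subset_weight V q A * of_bool (A \<inter> {v} = {}))"
    by (rule sum.cong) (simp_all only: card_eq sum_distrib_left right_diff_distrib mult_1_right)
  also have "\<dots> = (\<Sum>v\<in>V. \<Sum>A\<in>Pow V. subset_weight V q A
            - subset_weight V q A * of_bool (A \<inter> {v} = {}))"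
    by (rule sum.swap)
  also have "\<dots> = (\<Sum>v\<in>V. 1 - q)"
  proof (rule sum.cong)
    fix v assume "v \<in> V"
    then have "(\<Sum>A\<in>Pow V. subset_weight V q A * of_bool (A \<inter> {v} = {})) = q"
      using sum_subset_weight_avoid[OF assms, of "{v}" q] by simp
    then show "(\<Sum>A\<in>Pow V. subset_weight V q A
        - subset_weight V q A * of_bool (A \<inter> {v} = {})) = 1 - q"
      by (simp only: sum_subtractf sum_subset_weight[OF assms])
  qed simp
  finally show ?thesis by simp
qed

section \<open>The expected deficit of a vertex\<close>

text \<open>
  If \<open>t\<close> exceeds \<open>card (N \<inter> A)\<close>, pick a set \<open>F \<subseteq> N - A\<close> that supplies exactly the missing elements.
  Omitting one element of \<open>F\<close> from \<open>(N \<inter> A) \<union> F\<close> leaves \<open>t - 1\<close> elements, and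
  different omissions give different sets. So a deficit, which is a count, is bounded
  by a sum of indicators of events that are easy to handle.
\<close>
lemma deficit_le_card_supersets:
  assumes "finite N" "t \<le> card N"
  shows "t - card (N \<inter> A) \<le> card {S. S \<subseteq> N \<and> card S = t - 1 \<and> N \<inter> A \<subseteq> S}"
proof (cases "t \<le> card (N \<inter> A)")
  case False
  have "card (N - A) = card N - card (N \<inter> A)"
    using assms by (simp add: card_Diff_subset_Int)
  then obtain F where F: "F \<subseteq> N - A" "card F = t - card (N \<inter> A)"
    using assms obtain_subset_with_card_n[of "t - card (N \<inter> A)" "N - A"]
    by (metis diff_le_mono)
  have finF: "finite F" using F assms finite_subset by blast
  let ?S = "\<lambda>x. (N \<inter> A) \<union> (F - {x})"
  have "inj_on ?S F"
  proof (rule inj_onI)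
    fix x y assume "x \<in> F" "y \<in> F" "?S x = ?S y"
    then show "x = y" using F by blast
  qed
  moreover have "?S ` F \<subseteq> {S. S \<subseteq> N \<and> card S = t - 1 \<and> N \<inter> A \<subseteq> S}"
  proof (clarsimp, intro conjI)
    fix x assume x: "x \<in> F"
    have "card (?S x) = card (N \<inter> A) + card (F - {x})"
      by (rule card_Un_disjoint) (use assms finF F in auto)
    then show "card (?S x) = t - Suc 0"
      using x F finF False by simp
  next
    fix x show "F - {x} \<subseteq> N" using F by auto
  qed
  moreover have "finite {S. S \<subseteq> N \<and> card S = t - 1 \<and> N \<inter> A \<subseteq> S}"
    using assms by simp
  ultimately have "card F \<le> card {S. S \<subseteq> N \<and> card S = t - 1 \<and> N \<inter> A \<subseteq> S}"
    by (rule card_inj_on_le)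
  then show ?thesis using F by simp
qed simp

text \<open>
  A set \<open>S\<close> counted by the previous lemma contains \<open>N \<inter> A\<close> iff \<open>A\<close> avoids \<open>N - S\<close>. The set
  \<open>U\<close> gives one statement for two uses: \<open>U = {}\<close> for an unconditional deficit, and
  \<open>U = {v}\<close> for the deficit counted only when \<open>v\<close> itself was not chosen.
\<close>
lemma expected_deficit_le:
  assumes V: "finite V" "N \<subseteq> V" "U \<subseteq> V" "U \<inter> N = {}"
    and t: "t \<le> card N" and q: "0 \<le> q" "q \<le> 1"
  shows "(\<Sum>A\<in>Pow V. subset_weight V q A * (of_bool (A \<inter> U = {}) * real (t - card (N \<inter> A))))
      \<le> (if t = 0 then 0
          else real (card N choose (t - 1)) * q ^ (card U + card N + 1 - t))"
proof (cases "t = 0")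
  case False
  define \<S> where "\<S> = {S. S \<subseteq> N \<and> card S = t - 1}"
  have finN: "finite N" and finU: "finite U"
    using V finite_subset by blast+
  have fin: "finite \<S>" using finN by (simp add: \<S>_def)
  have "(\<Sum>A\<in>Pow V. subset_weight V q A * (of_bool (A \<inter> U = {}) * real (t - card (N \<inter> A))))
      \<le> (\<Sum>A\<in>Pow V. \<Sum>S\<in>\<S>. subset_weight V q A * of_bool (A \<inter> (U \<union> (N - S)) = {}))"
  proof (rule sum_mono)
    fix A
    have "real (t - card (N \<inter> A)) \<le> real (card {S. S \<subseteq> N \<and> card S = t - 1 \<and> N \<inter> A \<subseteq> S})"
      using deficit_le_card_supersets[OF finN t] of_nat_le_iff by blast
    also have "{S. S \<subseteq> N \<and> card S = t - 1 \<and> N \<inter> A \<subseteq> S} = \<S> \<inter> {S. A \<inter> (N - S) = {}}"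
      by (auto simp: \<S>_def)
    also have "real (card \<dots>) = (\<Sum>S\<in>\<S>. of_bool (A \<inter> (N - S) = {}))"
      using fin by simp
    finally have "of_bool (A \<inter> U = {}) * real (t - card (N \<inter> A))
        \<le> of_bool (A \<inter> U = {}) * (\<Sum>S\<in>\<S>. of_bool (A \<inter> (N - S) = {}))"
      by (rule mult_left_mono) simp
    also have "\<dots> = (\<Sum>S\<in>\<S>. of_bool (A \<inter> (U \<union> (N - S)) = {}))"
      unfolding sum_distrib_left by (rule sum.cong) auto
    finally show "subset_weight V q A * (of_bool (A \<inter> U = {}) * real (t - card (N \<inter> A)))
        \<le> (\<Sum>S\<in>\<S>. subset_weight V q A * of_bool (A \<inter> (U \<union> (N - S)) = {}))"
      unfolding sum_distrib_left[symmetric]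
      by (rule mult_left_mono) (rule subset_weight_nonneg[OF q])
  qed
  also have "\<dots> = (\<Sum>S\<in>\<S>. \<Sum>A\<in>Pow V. subset_weight V q A * of_bool (A \<inter> (U \<union> (N - S)) = {}))"
    by (rule sum.swap)
  also have "\<dots> = (\<Sum>S\<in>\<S>. q ^ (card U + card N + 1 - t))"
  proof (rule sum.cong)
    fix S assume "S \<in> \<S>"
    then have S: "S \<subseteq> N" "card S = t - 1" by (auto simp: \<S>_def)
    have "card (U \<union> (N - S)) = card U + card (N - S)"
      by (rule card_Un_disjoint) (use V finN finU in auto)
    also have "\<dots> = card U + card N + 1 - t"
      using S False t finN finite_subset[OF S(1)] by (simp add: card_Diff_subset)
    finally show "(\<Sum>A\<in>Pow V. subset_weight V q A * of_bool (A \<inter> (U \<union> (N - S)) = {}))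
        = q ^ (card U + card N + 1 - t)"
      using sum_subset_weight_avoid[OF V(1), of "U \<union> (N - S)" q] V by auto
  qed simp
  also have "\<dots> = real (card N choose (t - 1)) * q ^ (card U + card N + 1 - t)"
    using n_subsets[OF finN] by (simp add: \<S>_def)
  finally show ?thesis using False by simp
qed simp

section \<open>Repairing a vertex subset to a dominating set\<close>

lemma exists_repaired_superset:
  fixes N :: "'a \<Rightarrow> 'a set"
  assumes V: "finite V" "A \<subseteq> V"
    and N: "\<And>v. v \<in> V \<Longrightarrow> N v \<subseteq> V"
    and t: "\<And>v. v \<in> V \<Longrightarrow> t v \<le> card (N v)"
  shows "\<exists>D. A \<subseteq> D \<and> D \<subseteq> V \<and> (\<forall>v\<in>V. t v \<le> card (N v \<inter> D))
    \<and> card D \<le> card A + (\<Sum>v\<in>V. t v - card (N v \<inter> A))"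
proof -
  have finN: "finite (N v)" if "v \<in> V" for v using N[OF that] V finite_subset by blast
  have "\<exists>F. F \<subseteq> N v - A \<and> card F = t v - card (N v \<inter> A)" if "v \<in> V" for v
  proof -
    have "card (N v - A) = card (N v) - card (N v \<inter> A)"
      using finN[OF that] by (simp add: card_Diff_subset_Int)
    then show ?thesis
      using t[OF that] obtain_subset_with_card_n[of "t v - card (N v \<inter> A)" "N v - A"]
      by (metis diff_le_mono)
  qed
  then obtain F where F: "\<And>v. v \<in> V \<Longrightarrow> F v \<subseteq> N v - A"
      "\<And>v. v \<in> V \<Longrightarrow> card (F v) = t v - card (N v \<inter> A)"
    by metis
  define D where "D = A \<union> (\<Union>v\<in>V. F v)"
  have DV: "D \<subseteq> V" using V N F by (fastforce simp: D_def)
  have "t v \<le> card (N v \<inter> D)" if v: "v \<in> V" for v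
  proof -
    have "t v \<le> card (N v \<inter> A) + card (F v)" using F(2)[OF v] by simp
    also have "\<dots> = card (N v \<inter> A \<union> F v)"
      by (rule card_Un_disjoint[symmetric]) (use F(1)[OF v] finN[OF v] finite_subset in auto)
    also have "\<dots> \<le> card (N v \<inter> D)"
      by (rule card_mono) (use F(1)[OF v] finN[OF v] v in \<open>auto simp: D_def\<close>)
    finally show ?thesis .
  qed
  moreover have "card D \<le> card A + (\<Sum>v\<in>V. t v - card (N v \<inter> A))"
  proof -
    have "card D \<le> card A + card (\<Union>v\<in>V. F v)"
      unfolding D_def by (rule card_Un_le)
    also have "card (\<Union>v\<in>V. F v) \<le> (\<Sum>v\<in>V. card (F v))"
      by (rule card_UN_le[OF V(1)])
    finally show ?thesis using F(2) by simp
  qed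
  ultimately show ?thesis using DV by (auto simp: D_def)
qed

section \<open>Minimum degree and dominating sets\<close>

lemma parametric_domination_number_le:
  assumes "finite (pverts G)" "kl_dominating_set k l G D"
  shows "parametric_domination_number k l G \<le> card D"
proof -
  have "{D. kl_dominating_set k l G D} \<subseteq> Pow (pverts G)"
    by (auto simp: kl_dominating_set_def)
  then have "finite {D. kl_dominating_set k l G D}"
    using assms(1) finite_subset by blast
  then show ?thesis
    unfolding parametric_domination_number_def using assms(2) by (auto intro: Min_le)
qed

lemma exists_min_degree_neighbours:
  assumes "pair_graph G" "v \<in> pverts G"
  shows "\<exists>N. N \<subseteq> pverts G - {v} \<and> N \<subseteq> {u. (v, u) \<in> parcs G} \<and> card N = min_degree G"
proof -
  interpret pair_graph G by fact
  let ?M = "{u. (v, u) \<in> parcs G}"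
  have "min_degree G \<le> out_degree (with_proj G) v"
    unfolding min_degree_def using assms by (intro Min_le) auto
  also have "\<dots> = card (Pair v ` ?M)"
    unfolding out_degree_def out_arcs_def by (rule arg_cong[where f = card]) auto
  also have "\<dots> = card ?M"
    by (rule card_image) (simp add: inj_on_def)
  finally obtain N where "N \<subseteq> ?M" "card N = min_degree G"
    using obtain_subset_with_card_n by metis
  moreover have "?M \<subseteq> pverts G - {v}"
    using in_arcsD2 no_loops by fastforce
  ultimately show ?thesis by blast
qed

text \<open>
  A member of \<open>D\<close> counts itself in its closed neighbourhood, so it needs
  only \<open>l - 1\<close> open neighbours in \<open>D\<close>.
\<close>
lemma kl_dominating_setI:
  assumes fin: "finite (pverts G)" and D: "D \<subseteq> pverts G"
    and N: "\<And>v. v \<in> pverts G \<Longrightarrow> N v \<subseteq> pverts G - {v}"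
      "\<And>v. v \<in> pverts G \<Longrightarrow> N v \<subseteq> {u. (v, u) \<in> parcs G}"
    and out: "\<And>v. v \<in> pverts G - D \<Longrightarrow> k \<le> card (N v \<inter> D)"
    and ins: "\<And>v. v \<in> D \<Longrightarrow> l - 1 \<le> card (N v \<inter> D)"
  shows "kl_dominating_set k l G D"
proof -
  have finD: "finite D" using fin D finite_subset by blast
  show ?thesis
    unfolding kl_dominating_set_def
  proof (intro conjI ballI)
    fix v assume v: "v \<in> pverts G - D"
    then have "card (N v \<inter> D) \<le> card (closed_nbhd G v \<inter> D)"
      using N(2)[of v] finD by (intro card_mono) (auto simp: closed_nbhd_def)
    with out[OF v] show "k \<le> card (closed_nbhd G v \<inter> D)" by linarith
  next
    fix v assume v: "v \<in> D"
    have "card (insert v (N v \<inter> D)) \<le> card (closed_nbhd G v \<inter> D)"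
      using N(2)[of v] finD v D by (intro card_mono) (auto simp: closed_nbhd_def)
    moreover have "card (insert v (N v \<inter> D)) = Suc (card (N v \<inter> D))"
      using N(1)[of v] v D finD by (intro card_insert_disjoint) auto
    ultimately show "l \<le> card (closed_nbhd G v \<inter> D)"
      using ins[OF v] by linarith
  qed (rule D)
qed

section \<open>The bound for an arbitrary probability and its optimisation\<close>

text \<open>
  The weighted average of the sizes of the repaired sets bounds the minimum size of a
  dominating set. The variable \<open>q\<close> is left free, since the two inequalities of the theorem
  come from different choices of it.
\<close>
lemma parametric_domination_number_le_poly:
  fixes q :: real
  assumes G: "pair_graph G" and \<delta>: "\<delta> = min_degree G"
    and kl: "1 \<le> k" "1 \<le> l" "k \<le> \<delta>" "l \<le> \<delta> + 1" and q: "0 \<le> q" "q \<le> 1"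
  shows "real (parametric_domination_number k l G)
    \<le> real (card (pverts G)) * (1 - q + (real (\<delta> choose (k - 1))
        + (if l = 1 then 0 else real (\<delta> choose (l - 2)))) * q ^ (\<delta> + 2 - max k l))"
proof -
  interpret pair_graph G by fact
  let ?V = "pverts G"
  let ?\<gamma> = "real (parametric_domination_number k l G)"
  let ?w = "subset_weight ?V q"
  let ?m = "\<delta> + 2 - max k l"
  let ?B = "(real (\<delta> choose (k - 1))
    + (if l = 1 then 0 else real (\<delta> choose (l - 2)))) * q ^ ?m"
  have fin: "finite ?V" by (rule finite_verts)
  obtain N where N: "\<And>v. v \<in> ?V \<Longrightarrow> N v \<subseteq> ?V - {v}"
      "\<And>v. v \<in> ?V \<Longrightarrow> N v \<subseteq> {u. (v, u) \<in> parcs G}"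
      "\<And>v. v \<in> ?V \<Longrightarrow> card (N v) = \<delta>"
    using exists_min_degree_neighbours[OF G] unfolding \<delta> by metis
  (* A vertex outside A may enter D during the repair, so its target must cover both demands. *)
  define t where "t A v = (if v \<in> A then l - 1 else max k (l - 1))" for A and v :: 'a
  have t_le: "t A v \<le> card (N v)" if "v \<in> ?V" for A v
    using kl N(3)[OF that] by (auto simp: t_def)
  have repaired: "?\<gamma> \<le> real (card A) + (\<Sum>v\<in>?V. real (t A v - card (N v \<inter> A)))"
    if A: "A \<in> Pow ?V" for A
  proof -
    have "\<exists>D. A \<subseteq> D \<and> D \<subseteq> ?V \<and> (\<forall>v\<in>?V. t A v \<le> card (N v \<inter> D))
        \<and> card D \<le> card A + (\<Sum>v\<in>?V. t A v - card (N v \<inter> A))"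
      by (rule exists_repaired_superset) (use fin A N(1) t_le in auto)
    then obtain D where D: "A \<subseteq> D" "D \<subseteq> ?V" "\<forall>v\<in>?V. t A v \<le> card (N v \<inter> D)"
        "card D \<le> card A + (\<Sum>v\<in>?V. t A v - card (N v \<inter> A))"
      by (elim exE conjE) (rule that)
    have "kl_dominating_set k l G D"
    proof (rule kl_dominating_setI[OF fin D(2) N(1,2)])
      fix v assume "v \<in> ?V - D"
      then show "k \<le> card (N v \<inter> D)"
        using D(3)[rule_format, of v] D(1) by (auto simp: t_def split: if_splits)
    next
      fix v assume "v \<in> D"
      then show "l - 1 \<le> card (N v \<inter> D)"
        using D(3)[rule_format, of v] D(2) by (auto simp: t_def split: if_splits)
    qed
    then have "parametric_domination_number k l G \<le> card D"
      by (rule parametric_domination_number_le[OF fin])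
    then show ?thesis using D(4) by (simp flip: of_nat_sum of_nat_add)
  qed
  have deficit: "(\<Sum>A\<in>Pow ?V. ?w A * real (t A v - card (N v \<inter> A))) \<le> ?B"
    if v: "v \<in> ?V" for v
  proof -
    have Nv: "N v \<subseteq> ?V" "{v} \<inter> N v = {}" using N(1)[OF v] by auto
    have inside: "(\<Sum>A\<in>Pow ?V. ?w A * real (l - 1 - card (N v \<inter> A)))
        \<le> (if l = 1 then 0 else real (\<delta> choose (l - 2)) * q ^ (\<delta> + 2 - l))"
    proof -
      have idx: "(l - 1 = 0) = (l = 1)" "l - 1 - 1 = l - 2"
          "card ({} :: 'a set) + \<delta> + 1 - (l - 1) = \<delta> + 2 - l"
        using kl by auto
      have "l - 1 \<le> card (N v)" using kl N(3)[OF v] by simp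
      from expected_deficit_le[OF fin Nv(1) empty_subsetI Int_empty_left this q]
      show ?thesis
        unfolding N(3)[OF v] idx by (simp only: Int_empty_right simp_thms of_bool_eq mult_1)
    qed
    have outside: "(\<Sum>A\<in>Pow ?V. ?w A * (of_bool (A \<inter> {v} = {}) * real (k - card (N v \<inter> A))))
        \<le> real (\<delta> choose (k - 1)) * q ^ (\<delta> + 2 - k)"
    proof -
      have idx: "(k = 0) = False" "card {v} + \<delta> + 1 - k = \<delta> + 2 - k"
        using kl by auto
      have "k \<le> card (N v)" "{v} \<subseteq> ?V" using kl N(3)[OF v] v by simp_all
      from expected_deficit_le[OF fin Nv(1) this(2) Nv(2) this(1) q]
      show ?thesis
        unfolding N(3)[OF v] idx by (simp only: if_False)
    qed
    show ?thesis
    proof (cases "k < l")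
      case True
      then have "t A v = l - 1" for A by (auto simp: t_def max_def)
      moreover have "max k l = l" "l \<noteq> 1" using True kl by auto
      ultimately have "(\<Sum>A\<in>Pow ?V. ?w A * real (t A v - card (N v \<inter> A)))
          \<le> real (\<delta> choose (l - 2)) * q ^ ?m"
        using inside by (simp only: if_False)
      also have "\<dots> \<le> ?B" using True kl q by (intro mult_right_mono) auto
      finally show ?thesis .
    next
      case False
      (* The deficit of a chosen vertex is bounded without the factor for being chosen: its
         power of q is already at least as high as the required one. *)
      have "(\<Sum>A\<in>Pow ?V. ?w A * real (t A v - card (N v \<inter> A)))
          \<le> (\<Sum>A\<in>Pow ?V. ?w A * (of_bool (A \<inter> {v} = {}) * real (k - card (N v \<inter> A)))
              + ?w A * real (l - 1 - card (N v \<inter> A)))"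
        unfolding distrib_left[symmetric]
        by (intro sum_mono mult_left_mono subset_weight_nonneg q)
          (use False in \<open>auto simp: t_def max_def\<close>)
      also have "\<dots> \<le> real (\<delta> choose (k - 1)) * q ^ (\<delta> + 2 - k)
          + (if l = 1 then 0 else real (\<delta> choose (l - 2)) * q ^ (\<delta> + 2 - l))"
        unfolding sum.distrib by (rule add_mono[OF outside inside])
      also have "\<dots> \<le> ?B"
      proof -
        have "q ^ (\<delta> + 2 - l) \<le> q ^ (\<delta> + 2 - k)"
          using False q by (intro power_decreasing) auto
        then show ?thesis
          using False by (auto simp: distrib_right max_def intro!: mult_left_mono)
      qed
      finally show ?thesis .
    qed
  qed
  have "?\<gamma> = (\<Sum>A\<in>Pow ?V. ?w A * ?\<gamma>)"
    using sum_subset_weight[OF fin, of q] by (simp flip: sum_distrib_right)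
  also have "\<dots> \<le> (\<Sum>A\<in>Pow ?V. ?w A * real (card A)
      + (\<Sum>v\<in>?V. ?w A * real (t A v - card (N v \<inter> A))))"
    unfolding sum_distrib_left[symmetric] distrib_left[symmetric]
    by (intro sum_mono mult_left_mono repaired subset_weight_nonneg q)
  also have "\<dots> = real (card ?V) * (1 - q)
      + (\<Sum>v\<in>?V. \<Sum>A\<in>Pow ?V. ?w A * real (t A v - card (N v \<inter> A)))"
    unfolding sum.distrib sum_subset_weight_card[OF fin] by (simp add: sum.swap[of _ ?V])
  also have "\<dots> \<le> real (card ?V) * (1 - q) + (\<Sum>v\<in>?V. ?B)"
    by (intro add_left_mono sum_mono deficit)
  also have "\<dots> = real (card ?V) * (1 - q + ?B)"
    by (simp add: algebra_simps)
  finally show ?thesis .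
qed

text \<open>
  At \<open>q = 0\<close> the random set is the whole vertex set, and the exponent is positive.
\<close>
lemma parametric_domination_number_le_card:
  assumes "pair_graph G" "1 \<le> k" "1 \<le> l" "k \<le> min_degree G" "l \<le> min_degree G + 1"
  shows "real (parametric_domination_number k l G) \<le> real (card (pverts G))"
proof -
  have zero: "(0::real) ^ (min_degree G + 2 - max k l) = 0"
    using assms by (simp add: zero_power)
  show ?thesis
    using parametric_domination_number_le_poly[OF assms(1) refl assms(2-5), of 0]
    unfolding zero by simp
qed

text \<open>
  This \<open>q\<close> is the critical point of \<open>1 - q + c q ^ (1 + d)\<close>, the solution of
  \<open>c (1 + d) q ^ d = 1\<close>. There the last term equals \<open>q / (1 + d)\<close>.
\<close>
lemma optimal_avoidance_probability:
  fixes c d :: real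
  assumes "0 < d" "0 < c"
  defines "q \<equiv> (c * (1 + d)) powr (- 1 / d)"
  shows "1 - q + c * q powr (1 + d) = 1 - d / ((1 + d) powr (1 + 1 / d) * c powr (1 / d))"
proof -
  have "q powr d = 1 / (c * (1 + d))"
    using assms(1,2) unfolding q_def powr_powr by (simp add: powr_minus_divide)
  moreover have "q > 0" using assms by (simp add: q_def)
  ultimately have "c * q powr (1 + d) = q / (1 + d)"
    using assms(1,2) by (simp add: powr_add)
  then have "1 - q + c * q powr (1 + d) = 1 - d / (1 + d) * q"
    using assms(1,2) by (simp add: field_simps)
  also have "d / (1 + d) * q = d / ((1 + d) powr (1 + 1 / d) * c powr (1 / d))"
    using assms(1,2) unfolding q_def by (simp add: powr_minus_divide powr_mult powr_add mult_ac)
  finally show ?thesis .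
qed

theorem theorem6:
  fixes G :: "'a pair_pre_digraph"
    and k l n \<delta> :: nat
    and \<delta>h :: real
    and b :: "int \<Rightarrow> real"
  assumes "pair_graph G" and "pverts G \<noteq> {}"
    and "k \<ge> 1" and "l \<ge> 1"
    and "n = card (pverts G)"
    and "\<delta> = min_degree G"
    and "\<delta>h = real \<delta> - real (max k l) + 1"
    and "\<And>t::nat. b (int t) = real (\<delta> choose t)" and "b (-1) = 0"
  shows "(\<delta>h > 0 \<longrightarrow>
            real (parametric_domination_number k l G) \<le>
              (1 - \<delta>h / ((1 + \<delta>h) powr (1 + 1 / \<delta>h) *
                         (b (int k - 1) + b (int l - 2)) powr (1 / \<delta>h))) * real n) \<and>
         (int \<delta> \<ge> max (int k) (int l - 1) \<longrightarrow>
            real (parametric_domination_number k l G) \<le>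
              (ln (\<delta>h + 1) + ln (b (int k - 1) + b (int l - 2)) + 1) / (\<delta>h + 1) * real n)"
proof -
  define c where "c = b (int k - 1) + b (int l - 2)"
  have "b (int k - 1) = real (\<delta> choose (k - 1))"
    using assms(8)[of "k - 1"] \<open>k \<ge> 1\<close> by (simp add: of_nat_diff)
  moreover have "b (int l - 2) = (if l = 1 then 0 else real (\<delta> choose (l - 2)))"
  proof (cases "l = 1")
    case False
    then have "int (l - 2) = int l - 2" using \<open>l \<ge> 1\<close> by simp
    then show ?thesis using assms(8)[of "l - 2"] False by simp
  qed (use \<open>b (-1) = 0\<close> in simp)
  ultimately have c: "c = real (\<delta> choose (k - 1))
      + (if l = 1 then 0 else real (\<delta> choose (l - 2)))"
    by (simp add: c_def)
  have c_ge: "1 \<le> c" if "k \<le> \<delta>"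
  proof -
    have "1 \<le> \<delta> choose (k - 1)" using that by (simp add: Suc_le_eq)
    then have "1 \<le> real (\<delta> choose (k - 1))" by linarith
    then show ?thesis unfolding c by (intro add_increasing2) auto
  qed
  have poly: "real (parametric_domination_number k l G)
      \<le> real n * (1 - q + c * q ^ (\<delta> + 2 - max k l))"
    if "k \<le> \<delta>" "l \<le> \<delta> + 1" "0 \<le> q" "q \<le> 1" for q
    unfolding c \<open>n = _\<close> using parametric_domination_number_le_poly assms that by blast
  have expo: "real (\<delta> + 2 - max k l) = 1 + \<delta>h" if "k \<le> \<delta>" "l \<le> \<delta> + 1"
    using that \<open>\<delta>h = _\<close> by (auto simp: max_def of_nat_diff)
  have "real (parametric_domination_number k l G) \<le>
      (1 - \<delta>h / ((1 + \<delta>h) powr (1 + 1 / \<delta>h) * c powr (1 / \<delta>h))) * real n"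
    if pos: "\<delta>h > 0"
  proof -
    have kl: "k \<le> \<delta>" "l \<le> \<delta> + 1" using pos \<open>\<delta>h = _\<close> by auto
    define q where "q = (c * (1 + \<delta>h)) powr (- 1 / \<delta>h)"
    have "1 * 1 \<le> c * (1 + \<delta>h)" using c_ge[OF kl(1)] pos by (intro mult_mono) auto
    then have q: "0 < q" "q \<le> 1"
      using pos ge_one_powr_ge_zero[of "c * (1 + \<delta>h)" "1 / \<delta>h"]
      by (auto simp: q_def powr_minus_divide divide_le_eq)
    have "q ^ (\<delta> + 2 - max k l) = q powr (1 + \<delta>h)"
      unfolding expo[OF kl, symmetric] using q by (simp only: powr_realpow)
    moreover have "1 - q + c * q powr (1 + \<delta>h)
        = 1 - \<delta>h / ((1 + \<delta>h) powr (1 + 1 / \<delta>h) * c powr (1 / \<delta>h))"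
      unfolding q_def using pos c_ge[OF kl(1)] by (intro optimal_avoidance_probability) auto
    ultimately show ?thesis
      using poly[OF kl, of q] q by (simp only: mult.commute less_imp_le)
  qed
  moreover have "real (parametric_domination_number k l G) \<le>
      (ln (\<delta>h + 1) + ln c + 1) / (\<delta>h + 1) * real n"
    if "int \<delta> \<ge> max (int k) (int l - 1)"
  proof -
    have kl: "k \<le> \<delta>" "l \<le> \<delta> + 1" using that by auto
    have m: "1 \<le> \<delta>h + 1" using kl \<open>\<delta>h = _\<close> by (auto simp: max_def)
    have c1: "1 \<le> c" by (rule c_ge[OF kl(1)])
    (* The critical point of p + c exp (- p (\<delta>h + 1)). It may exceed 1, and then it is not a
       probability, but the claimed bound is larger than n. *)
    define p where "p = ln ((\<delta>h + 1) * c) / (\<delta>h + 1)"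
    have "1 * 1 \<le> (\<delta>h + 1) * c" using m c1 by (intro mult_mono) auto
    then have p0: "0 \<le> p" using m by (simp add: p_def)
    have rhs: "(ln (\<delta>h + 1) + ln c + 1) / (\<delta>h + 1) = p + 1 / (\<delta>h + 1)"
      using m c1 by (simp add: p_def ln_mult add_divide_distrib)
    have "real (parametric_domination_number k l G) \<le> (p + 1 / (\<delta>h + 1)) * real n"
    proof (cases "p \<le> 1")
      case True
      have "(1 - p) ^ (\<delta> + 2 - max k l) \<le> exp (- p) ^ (\<delta> + 2 - max k l)"
        using True exp_ge_add_one_self[of "- p"] by (intro power_mono) auto
      also have "\<dots> = exp (- ln ((\<delta>h + 1) * c))"
        unfolding exp_of_nat_mult[symmetric] expo[OF kl]
        using m by (simp add: p_def add.commute)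
      also have "\<dots> = 1 / ((\<delta>h + 1) * c)"
        using m c1 by (simp add: exp_minus inverse_eq_divide)
      finally have "c * (1 - p) ^ (\<delta> + 2 - max k l) \<le> c * (1 / ((\<delta>h + 1) * c))"
        using c1 by (intro mult_left_mono) auto
      also have "\<dots> = 1 / (\<delta>h + 1)" using c1 by simp
      finally have "1 - (1 - p) + c * (1 - p) ^ (\<delta> + 2 - max k l) \<le> p + 1 / (\<delta>h + 1)"
        by simp
      then have "real n * (1 - (1 - p) + c * (1 - p) ^ (\<delta> + 2 - max k l))
          \<le> real n * (p + 1 / (\<delta>h + 1))"
        by (rule mult_left_mono) simp
      with poly[OF kl, of "1 - p"] True p0 show ?thesis
        by (simp add: mult.commute)
    next
      case False
      have "real (parametric_domination_number k l G) \<le> 1 * real n"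
        using parametric_domination_number_le_card[of G k l] assms kl by simp
      also have "\<dots> \<le> (p + 1 / (\<delta>h + 1)) * real n"
        using False m by (intro mult_right_mono) (auto simp: add_increasing2)
      finally show ?thesis .
    qed
    then show ?thesis by (simp only: rhs)
  qed
  ultimately show ?thesis unfolding c_def by blast
qed

end
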